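(* $\mathsf{lim}_2\not\leq_{\mathsf{W}}\mathsf{OG\mapsto\alpha}$, where $\mathsf{OG\mapsto\alpha}$ is the problem which, given a countable ordered group $(G,\leq)$, outputs a copy of the well-order $\alpha$ such that the order type of $G$ is $\mathbb{Z}^{\alpha}\mathbb{Q}^{\epsilon}$ for some $\epsilon\in\{0,1\}$.
   Context: Weihrauch reducibility: a represented space is a set $X$ with a partial surjection $\delta_X:\subseteq\mathbb{N}^{\mathbb{N}}\to X$; if $\delta_X(p)=x$, $p$ is a name of $x$. A problem is a partial multi-valued function between represented spaces. $f\leq_{\mathsf{W}}g$ iff there are computable partial functions $\Phi,\Psi$ on Baire space such that whenever $p$ is a name of some $x\in\mathrm{dom}(f)$, $\Phi(p)$ is a name of some $z\in\mathrm{dom}(g)$, and for every name $q$ of an element of $g(z)$, $\Psi(p,q)$ is a name of an element of $f(x)$. Ordered groups: an ordered group is a group $G$ with a linear order $\leq$ such that $a\leq b$ implies $ag\leq bg$ and $ga\leq gb$ for all $g$. Countable ordered groups are presented on subsets of $\mathbb{N}$, a name coding the universe, operation and order. The order type of $G$ is a linear order $X$ such that there is an order-preserving bijection $G\to X$. For linear orders $X,Y$, the product $XY$ is $X\times Y$ with $\langle x_0,y_0\rangle<\langle x_1,y_1\rangle$ iff $y_0<y_1$, or $y_0=y_1$ and $x_0<x_1$. $\mathbb{Z}^X$ is the set of finitely supported functions $X\to\mathbb{Z}$, where for $f\neq g$, $f<g$ iff $f(x)<g(x)$ at the maximum $x$ where they differ. $\mathbb{Z}^\alpha\mathbb{Q}^0=\mathbb{Z}^\alpha$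 and $\mathbb{Z}^\alpha\mathbb{Q}^1=\mathbb{Z}^\alpha\mathbb{Q}$. By Maltsev's theorem every countable ordered group has order type $\mathbb{Z}^\alpha\mathbb{Q}^\epsilon$ for some ordinal $\alpha$ and $\epsilon\in\{0,1\}$. A copy of an ordinal $\alpha$ is a pair $(A,<_A)$ with $A\subseteq\mathbb{N}$, $<_A\subseteq A\times A$ a well-order of $A$ isomorphic to $\alpha$, coded in Baire space. $\mathsf{lim}_2:\subseteq 2^{\mathbb{N}}\to\{0,1\}$ is the limit operation: given a convergent (eventually constant) binary sequence, output its limit. *)

theory Defs
  imports Complex_Main "HOL-Library.Nat_Bijection" "HOL-Algebra.Group"
begin

section \<open>Computable partial functions on Baire space\<close>

type_synonym baire = "nat \<Rightarrow> nat"

text \<open>Programs for the partial recursive functions relative to an oracle (Kleene's schemes for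
  the partial recursive functions together with the oracle as an additional basic function).\<close>

datatype oprog =
    Zero
  | Succ
  | Proj nat
  | Query
  | Comp oprog "oprog list"
  | PrimRec oprog oprog
  | Mu oprog

text \<open>\<open>computes p e xs y\<close>: with oracle \<open>p\<close>, program \<open>e\<close> halts on the arguments \<open>xs\<close> with value \<open>y\<close>.\<close>

inductive computes :: "baire \<Rightarrow> oprog \<Rightarrow> nat list \<Rightarrow> nat \<Rightarrow> bool" for p :: baire where
  zero: "computes p Zero xs 0"
| succ: "computes p Succ [x] (Suc x)"
| proj: "i < length xs \<Longrightarrow> computes p (Proj i) xs (xs ! i)"
| query: "computes p Query [x] (p x)"
| comp: "list_all2 (\<lambda>g y. computes p g xs y) gs ys \<Longrightarrow> computes p f ys z \<Longrightarrow>
    computes p (Comp f gs) xs z"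
| primrec_0: "computes p f xs y \<Longrightarrow> computes p (PrimRec f g) (0 # xs) y"
| primrec_Suc: "computes p (PrimRec f g) (n # xs) r \<Longrightarrow> computes p g (n # r # xs) y \<Longrightarrow>
    computes p (PrimRec f g) (Suc n # xs) y"
| mu: "computes p f (n # xs) 0 \<Longrightarrow> (\<And>m. m < n \<Longrightarrow> \<exists>y. computes p f (m # xs) (Suc y)) \<Longrightarrow>
    computes p (Mu f) xs n"

text \<open>As usual in computable analysis, the domain of a computable partial function need not be the
  natural domain of the program: the program only has to be correct on it.\<close>

definition computable_baire :: "(baire \<Rightarrow> baire option) \<Rightarrow> bool" where
  "computable_baire F \<longleftrightarrow> (\<exists>e. \<forall>p q. F p = Some q \<longrightarrow> (\<forall>n. computes p e [n] (q n)))"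

definition baire_pair :: "baire \<Rightarrow> baire \<Rightarrow> baire" where
  "baire_pair p q n = (if even n then p (n div 2) else q (n div 2))"


section \<open>Represented spaces, problems and Weihrauch reducibility\<close>

text \<open>A represented space is given by its representation, a partial function on Baire space; the
  underlying set is the range of that partial function.\<close>

type_synonym 'a repr = "baire \<Rightarrow> 'a option"

definition space_of :: "'a repr \<Rightarrow> 'a set" where
  "space_of \<delta> = ran \<delta>"

record ('a, 'b) problem =
  in_rep :: "'a repr"
  out_rep :: "'b repr"
  solutions :: "'a \<Rightarrow> 'b set"

definition pdom :: "('a, 'b) problem \<Rightarrow> 'a set" where
  "pdom f = {x. solutions f x \<noteq> {}}"

definition is_problem :: "('a, 'b) problem \<Rightarrow> bool" where
  "is_problem f \<longleftrightarrow> pdom f \<subseteq> space_of (in_rep f) \<and> (\<forall>x. solutions f x \<subseteq> space_of (out_rep f))"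

definition weihrauch_le :: "('a, 'b) problem \<Rightarrow> ('c, 'd) problem \<Rightarrow> bool"
    (infix \<open>\<le>\<^sub>W\<close> 50) where
  "f \<le>\<^sub>W g \<longleftrightarrow> (\<exists>\<Phi> \<Psi>. computable_baire \<Phi> \<and> computable_baire \<Psi> \<and>
     (\<forall>p x. in_rep f p = Some x \<and> x \<in> pdom f \<longrightarrow>
       (\<exists>r z. \<Phi> p = Some r \<and> in_rep g r = Some z \<and> z \<in> pdom g \<and>
         (\<forall>q w. out_rep g q = Some w \<and> w \<in> solutions g z \<longrightarrow>
           (\<exists>s y. \<Psi> (baire_pair p q) = Some s \<and> out_rep f s = Some y \<and> y \<in> solutions f x)))))"

text \<open>The representation in which every point of \<open>X\<close> has exactly one name, given by an injective
  coding \<open>c\<close> of \<open>X\<close> in Baire space.\<close>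

definition rep_of_coding :: "'a set \<Rightarrow> ('a \<Rightarrow> baire) \<Rightarrow> 'a repr" where
  "rep_of_coding X c p = (if p \<in> c ` X then Some (the_inv_into X c p) else None)"

lemma rep_of_coding_eq_Some_iff:
  assumes "inj_on c X"
  shows "rep_of_coding X c p = Some x \<longleftrightarrow> x \<in> X \<and> p = c x"
  using assms by (auto simp: rep_of_coding_def the_inv_into_f_f)

lemma space_of_rep_of_coding:
  assumes "inj_on c X"
  shows "space_of (rep_of_coding X c) = X"
  using rep_of_coding_eq_Some_iff[OF assms] by (auto simp: space_of_def ran_def)


section \<open>The limit operation on binary sequences\<close>

definition cantor :: "baire set" where
  "cantor = {x. range x \<subseteq> {0, 1}}"

definition two_rep :: "nat repr" where
  "two_rep p = (if p 0 \<in> {0, 1} then Some (p 0) else None)"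

definition lim2 :: "(baire, nat) problem" where
  "lim2 = \<lparr> in_rep = rep_of_coding cantor id, out_rep = two_rep,
     solutions = (\<lambda>x. {l. x \<in> cantor \<and> x \<longlonglongrightarrow> l}) \<rparr>"


section \<open>Linear orders\<close>

text \<open>Linear orders are reflexive relations, the underlying set being the \<open>Field\<close>.\<close>

definition order_isomorphic :: "'a rel \<Rightarrow> 'b rel \<Rightarrow> bool" where
  "order_isomorphic r s \<longleftrightarrow> (\<exists>h. bij_betw h (Field r) (Field s) \<and>
     (\<forall>a\<in>Field r. \<forall>b\<in>Field r. (a, b) \<in> r \<longleftrightarrow> (h a, h b) \<in> s))"

definition order_prod :: "'a rel \<Rightarrow> 'b rel \<Rightarrow> ('a \<times> 'b) rel" where
  "order_prod r s = {((x0, y0), (x1, y1)) | x0 y0 x1 y1.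
     {x0, x1} \<subseteq> Field r \<and> {y0, y1} \<subseteq> Field s \<and>
     ((y0, y1) \<in> s \<and> y0 \<noteq> y1 \<or> y0 = y1 \<and> (x0, x1) \<in> r)}"

text \<open>Functions on the field of \<open>r\<close> are represented by functions vanishing outside of it.\<close>

definition finsupp :: "'a set \<Rightarrow> ('a \<Rightarrow> int) set" where
  "finsupp X = {f. finite {x. f x \<noteq> 0} \<and> {x. f x \<noteq> 0} \<subseteq> X}"

definition Zpow :: "'a rel \<Rightarrow> ('a \<Rightarrow> int) rel" where
  "Zpow r = {(f, g). f \<in> finsupp (Field r) \<and> g \<in> finsupp (Field r) \<and>
     (f = g \<or> (\<exists>x. f x < g x \<and> (\<forall>y. f y \<noteq> g y \<longrightarrow> (y, x) \<in> r)))}"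

definition rat_order :: "rat rel" where
  "rat_order = {(x, y). x \<le> y}"

definition has_type_ZQ :: "'a rel \<Rightarrow> 'b rel \<Rightarrow> nat \<Rightarrow> bool" where
  "has_type_ZQ r \<alpha> \<epsilon> \<longleftrightarrow>
     \<epsilon> = 0 \<and> order_isomorphic r (Zpow \<alpha>) \<or>
     \<epsilon> = 1 \<and> order_isomorphic r (order_prod (Zpow \<alpha>) rat_order)"


section \<open>Countable ordered groups\<close>

record 'a ogroup = "'a monoid" +
  gle :: "'a rel"

definition ordered_group :: "('a, 'm) ogroup_scheme \<Rightarrow> bool" where
  "ordered_group G \<longleftrightarrow> group G \<and> linear_order_on (carrier G) (gle G) \<and>
     (\<forall>a\<in>carrier G. \<forall>b\<in>carrier G. \<forall>g\<in>carrier G. (a, b) \<in> gle G \<longrightarrow>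
        (a \<otimes>\<^bsub>G\<^esub> g, b \<otimes>\<^bsub>G\<^esub> g) \<in> gle G \<and> (g \<otimes>\<^bsub>G\<^esub> a, g \<otimes>\<^bsub>G\<^esub> b) \<in> gle G)"

text \<open>The ordered groups whose universe is a set of natural numbers. Two of them are to be equal as
  soon as universe, operation and order agree, so the irrelevant values of the multiplication
  outside of the carrier are normalised.\<close>

definition countable_ogroups :: "nat ogroup set" where
  "countable_ogroups = {G. ordered_group G \<and>
     (\<forall>a b. \<not> (a \<in> carrier G \<and> b \<in> carrier G) \<longrightarrow> a \<otimes>\<^bsub>G\<^esub> b = undefined)}"

text \<open>The name of a group interleaves the characteristic functions of the universe, of the graph of
  the operation and of the order.\<close>

definition ogroup_code :: "nat ogroup \<Rightarrow> baire" where
  "ogroup_code G n =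
     (if n mod 3 = 0 then of_bool (n div 3 \<in> carrier G)
      else if n mod 3 = 1 then
        (case prod_decode (n div 3) of (a, m) \<Rightarrow> case prod_decode m of (b, c) \<Rightarrow>
           of_bool (a \<in> carrier G \<and> b \<in> carrier G \<and> a \<otimes>\<^bsub>G\<^esub> b = c))
      else of_bool (prod_decode (n div 3) \<in> gle G))"

lemma inj_on_ogroup_code: "inj_on ogroup_code countable_ogroups"
proof (rule inj_onI)
  fix G H :: "nat ogroup"
  assume G: "G \<in> countable_ogroups" and H: "H \<in> countable_ogroups"
    and eq: "ogroup_code G = ogroup_code H"
  have mod1: "(3 * x + 1) mod 3 = 1" "(3 * x + 1) div 3 = x" for x :: nat
    by presburger+
  have mod2: "(3 * x + 2) mod 3 = 2" "(3 * x + 2) div 3 = x" for x :: nat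
    by presburger+
  have code0: "ogroup_code K (3 * n) = of_bool (n \<in> carrier K)" for K n
    by (simp add: ogroup_code_def)
  have code1: "ogroup_code K (3 * prod_encode (a, prod_encode (b, c)) + 1) =
      of_bool (a \<in> carrier K \<and> b \<in> carrier K \<and> a \<otimes>\<^bsub>K\<^esub> b = c)" for K a b c
    unfolding ogroup_code_def mod1 by simp
  have code2: "ogroup_code K (3 * prod_encode c + 2) = of_bool (c \<in> gle K)" for K c
    unfolding ogroup_code_def mod2 by simp
  have "(of_bool (n \<in> carrier G) :: nat) = of_bool (n \<in> carrier H)" for n
    unfolding code0[symmetric] eq ..
  then have "n \<in> carrier G \<longleftrightarrow> n \<in> carrier H" for n
    by (simp only: of_bool_eq_iff)
  then have carr: "carrier G = carrier H" by blast
  have mult: "a \<otimes>\<^bsub>G\<^esub> b = a \<otimes>\<^bsub>H\<^esub> b" for a b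
  proof (cases "a \<in> carrier G \<and> b \<in> carrier G")
    case True
    let ?c = "a \<otimes>\<^bsub>G\<^esub> b"
    have "(of_bool (a \<in> carrier G \<and> b \<in> carrier G \<and> ?c = ?c) :: nat) =
        of_bool (a \<in> carrier H \<and> b \<in> carrier H \<and> a \<otimes>\<^bsub>H\<^esub> b = ?c)"
      unfolding code1[symmetric] eq ..
    then show ?thesis
      using True unfolding of_bool_eq_iff by metis
  next
    case False
    have "a \<otimes>\<^bsub>G\<^esub> b = undefined" "a \<otimes>\<^bsub>H\<^esub> b = undefined"
      using False G H carr unfolding countable_ogroups_def by blast+
    then show ?thesis by simp
  qed
  have "(of_bool (c \<in> gle G) :: nat) = of_bool (c \<in> gle H)" for c
    unfolding code2[symmetric] eq ..
  then have "c \<in> gle G \<longleftrightarrow> c \<in> gle H" for c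
    by (simp only: of_bool_eq_iff)
  then have le: "gle G = gle H" by blast
  have gr: "group G" "group H"
    using G H by (simp_all add: countable_ogroups_def ordered_group_def)
  have "\<one>\<^bsub>G\<^esub> = \<one>\<^bsub>G\<^esub> \<otimes>\<^bsub>H\<^esub> \<one>\<^bsub>H\<^esub>"
    using monoid.r_one[OF group.is_monoid[OF gr(2)], of "\<one>\<^bsub>G\<^esub>"]
      monoid.one_closed[OF group.is_monoid[OF gr(1)]] by (simp add: carr)
  also have "\<dots> = \<one>\<^bsub>H\<^esub>"
    using monoid.l_one[OF group.is_monoid[OF gr(1)], of "\<one>\<^bsub>H\<^esub>"]
      monoid.one_closed[OF group.is_monoid[OF gr(2)]] by (simp add: carr mult)
  finally have one: "\<one>\<^bsub>G\<^esub> = \<one>\<^bsub>H\<^esub>" .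
  have "monoid.mult G = monoid.mult H"
    using mult by (intro ext)
  with carr one le show "G = H" by (intro ogroup.equality) simp_all
qed


section \<open>Copies of well-orders\<close>

text \<open>\<open>L\<close> is the strict order, so that \<open>A\<close> has to be given separately (it is not determined by \<open>L\<close>
  if it is a singleton).\<close>

definition copies :: "'a rel \<Rightarrow> (nat set \<times> nat rel) set" where
  "copies \<alpha> = {(A, L). L \<inter> Id = {} \<and> well_order_on A (L \<union> Id_on A) \<and>
     order_isomorphic (L \<union> Id_on A) \<alpha>}"

definition relstructs :: "(nat set \<times> nat rel) set" where
  "relstructs = {(A, L). L \<subseteq> A \<times> A}"

definition relstruct_code :: "nat set \<times> nat rel \<Rightarrow> baire" where
  "relstruct_code = (\<lambda>(A, L). baire_pair (\<lambda>n. of_bool (n \<in> A)) (\<lambda>n. of_bool (prod_decode n \<in> L)))"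

lemma inj_on_relstruct_code: "inj_on relstruct_code relstructs"
proof (rule inj_onI)
  fix S T :: "nat set \<times> nat rel"
  assume eq: "relstruct_code S = relstruct_code T"
  obtain A L B M where ST: "S = (A, L)" "T = (B, M)" by fastforce
  have "n \<in> A \<longleftrightarrow> n \<in> B" for n
    using fun_cong[OF eq, of "2 * n"]
    by (auto simp: ST relstruct_code_def baire_pair_def of_bool_def split: if_splits)
  moreover have "c \<in> L \<longleftrightarrow> c \<in> M" for c
    using fun_cong[OF eq, of "2 * prod_encode c + 1"]
    by (auto simp: ST relstruct_code_def baire_pair_def of_bool_def split: if_splits)
  ultimately show "S = T" by (auto simp: ST)
qed


section \<open>From an ordered group to the exponent of its order type\<close>

text \<open>The ordinal \<open>\<alpha>\<close> ranges over well-orders of sets of natural numbers: an ordinal that has a copy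
  is isomorphic to one of these. By Maltsev's theorem every countable ordered group is in the
  domain.\<close>

definition og_to_alpha :: "(nat ogroup, nat set \<times> nat rel) problem" where
  "og_to_alpha = \<lparr> in_rep = rep_of_coding countable_ogroups ogroup_code,
     out_rep = rep_of_coding relstructs relstruct_code,
     solutions = (\<lambda>G. {c. G \<in> countable_ogroups \<and>
       (\<exists>\<alpha> :: nat rel. Well_order \<alpha> \<and> (\<exists>\<epsilon>\<in>{0, 1}. has_type_ZQ (gle G) \<alpha> \<epsilon>) \<and>
          c \<in> copies \<alpha>)}) \<rparr>"

lemma is_problem_lim2: "is_problem lim2"
proof -
  have "l \<in> {0, 1}" if x: "x \<in> cantor" and lim: "x \<longlonglongrightarrow> l" for x :: baire and l
  proof -
    obtain n where "x n = l"
      using lim unfolding tendsto_discrete eventually_sequentially by blast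
    then show ?thesis using x by (auto simp: cantor_def)
  qed
  moreover have "l \<in> ran two_rep" if "l \<in> {0, 1}" for l
    using that by (auto simp: ran_def two_rep_def intro!: exI[of _ "\<lambda>_. l"])
  ultimately show ?thesis
    by (auto simp: is_problem_def pdom_def lim2_def space_of_rep_of_coding space_of_def[of two_rep])
qed

lemma is_problem_og_to_alpha: "is_problem og_to_alpha"
proof -
  have "copies \<alpha> \<subseteq> relstructs" for \<alpha> :: "nat rel"
    by (auto simp: copies_def relstructs_def dest!: well_order_on_Field[symmetric] intro: FieldI1 FieldI2)
  then show ?thesis
    by (auto simp: is_problem_def pdom_def og_to_alpha_def
        space_of_rep_of_coding[OF inj_on_ogroup_code] space_of_rep_of_coding[OF inj_on_relstruct_code])
qed

end

theory Submission
  imports Defs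
begin

text \<open>Only the continuity of the backward functional matters. Among all convergent sequences choose
  one, \<open>x\<close>, whose associated ordinal has least cardinality, and a copy of that ordinal. The answer
  for \<open>x\<close> depends on a finite prefix of \<open>x\<close> and of the copy. Change \<open>x\<close> beyond this prefix into a
  sequence \<open>y\<close> with the other limit: by minimality the ordinal of \<open>y\<close> is large enough to have a copy
  with the same prefix, so that \<open>y\<close> receives the answer for \<open>x\<close>.\<close>

section \<open>Oracle computations: determinism and finite use of the oracle\<close>

lemma computes_deterministic:
  assumes "computes p e xs y" and "computes p e xs y'"
  shows "y = y'"
  using assms
proof (induction arbitrary: y' rule: computes.induct)
  case (comp xs gs ys f z)
  from comp.prems obtain ys' where ys': "list_all2 (\<lambda>g. computes p g xs) gs ys'"
      "computes p f ys' y'"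
    by (rule computes.cases) simp_all
  have "ys = ys'"
  proof (rule nth_equalityI)
    show "length ys = length ys'"
      using list_all2_lengthD[OF comp.IH(1)] list_all2_lengthD[OF ys'(1)] by simp
    show "ys ! i = ys' ! i" if "i < length ys" for i
      using list_all2_nthD2[OF comp.IH(1) that] list_all2_nthD[OF ys'(1), of i] that
        list_all2_lengthD[OF comp.IH(1)] by simp
  qed
  then show ?case using comp.IH(2) ys'(2) by blast
next
  case (primrec_0 f xs y g)
  from primrec_0.prems have "computes p f xs y'" by (rule computes.cases) simp_all
  then show ?case by (rule primrec_0.IH)
next
  case (primrec_Suc f g n xs r y)
  from primrec_Suc.prems obtain r' where r': "computes p (PrimRec f g) (n # xs) r'"
      "computes p g (n # r' # xs) y'"
    by (rule computes.cases) simp_all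
  with primrec_Suc.IH show ?case by blast
next
  case (mu f n xs)
  from mu.prems have zero: "computes p f (y' # xs) 0"
    by (rule computes.cases) simp_all
  from mu.prems have pos: "\<forall>m<y'. \<exists>y. computes p f (m # xs) (Suc y)"
    by (rule computes.cases) simp_all
  have "\<not> n < y'"
  proof
    assume "n < y'"
    then obtain y where "computes p f (n # xs) (Suc y)" using pos by blast
    from mu.IH(1)[OF this] show False by simp
  qed
  moreover have "\<not> y' < n"
  proof
    assume "y' < n"
    from mu.IH(2)[OF this] obtain y where "\<And>y''. computes p f (y' # xs) y'' \<Longrightarrow> Suc y = y''"
      by blast
    from this[OF zero] show False by simp
  qed
  ultimately show ?case by simp
qed (erule computes.cases; simp)+

text \<open>A halting computation asks its oracle only finitely many questions; \<open>m\<close>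
  bounds the positions asked.\<close>

lemma computes_continuous:
  assumes "computes p e xs y"
  shows "\<exists>m. \<forall>p'. (\<forall>i<m. p' i = p i) \<longrightarrow> computes p' e xs y"
  using assms
proof (induction rule: computes.induct)
  case (query x)
  show ?case
    by (intro exI[of _ "Suc x"]) (metis computes.query lessI)
next
  case (comp xs gs ys f z)
  from comp.IH(2) obtain m where m: "\<forall>p'. (\<forall>i<m. p' i = p i) \<longrightarrow> computes p' f ys z"
    by blast
  from comp.IH(1) have "\<forall>j<length gs. \<exists>m. \<forall>p'. (\<forall>i<m. p' i = p i) \<longrightarrow> computes p' (gs ! j) xs (ys ! j)"
    and len: "length gs = length ys"
    by (auto simp: list_all2_conv_all_nth)
  then obtain M where M: "\<And>j p'. j < length gs \<Longrightarrow> \<forall>i<M j. p' i = p i \<Longrightarrow> computes p' (gs ! j) xs (ys ! j)"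
    by metis
  \<comment> \<open>A sum bounds each of its terms, so this one prefix serves the outer program and
    all the inner ones.\<close>
  let ?k = "m + sum M {..<length gs}"
  show ?case
  proof (intro exI[of _ ?k] allI impI)
    fix p' assume p': "\<forall>i<?k. p' i = p i"
    have "M j \<le> ?k" if "j < length gs" for j
      using member_le_sum[of j "{..<length gs}" M] that by simp
    then have "list_all2 (\<lambda>g. computes p' g xs) gs ys"
      using p' M len by (fastforce simp: list_all2_conv_all_nth)
    moreover have "computes p' f ys z" using m p' by simp
    ultimately show "computes p' (Comp f gs) xs z" by (rule computes.comp)
  qed
next
  case (primrec_0 f xs y g)
  then show ?case by (blast intro: computes.primrec_0)
next
  case (primrec_Suc f g n xs r y)
  then obtain m1 m2 where
      "\<forall>p'. (\<forall>i<m1. p' i = p i) \<longrightarrow> computes p' (PrimRec f g) (n # xs) r"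
      "\<forall>p'. (\<forall>i<m2. p' i = p i) \<longrightarrow> computes p' g (n # r # xs) y"
    by blast
  then show ?case
    by (intro exI[of _ "m1 + m2"]) (auto intro!: computes.primrec_Suc[where r = r])
next
  case (mu f n xs)
  from mu.IH(1) obtain m where m: "\<forall>p'. (\<forall>i<m. p' i = p i) \<longrightarrow> computes p' f (n # xs) 0"
    by blast
  from mu.IH(2) have "\<forall>j<n. \<exists>y m. \<forall>p'. (\<forall>i<m. p' i = p i) \<longrightarrow> computes p' f (j # xs) (Suc y)"
    by blast
  then obtain Y M where M: "\<And>j p'. j < n \<Longrightarrow> \<forall>i<M j. p' i = p i \<Longrightarrow> computes p' f (j # xs) (Suc (Y j))"
    by metis
  let ?k = "m + sum M {..<n}"
  show ?case
  proof (intro exI[of _ ?k] allI impI)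
    fix p' assume p': "\<forall>i<?k. p' i = p i"
    have le: "M j \<le> ?k" if "j < n" for j
      using member_le_sum[of j "{..<n}" M] that by simp
    show "computes p' (Mu f) xs n"
    proof (rule computes.mu)
      show "computes p' f (n # xs) 0" using m p' by simp
      show "\<exists>y. computes p' f (j # xs) (Suc y)" if "j < n" for j
        using M[OF that, of p'] le[OF that] p' by fastforce
    qed
  qed
qed (auto intro: computes.intros)

section \<open>Well-orders and their copies\<close>

text \<open>Well-orders are comparable. If \<open>s\<close> were strictly shorter than
  \<open>r\<close>, it would be finite and embed onto a proper part of \<open>r\<close>, against the
  cardinality bound. An infinite \<open>s\<close> always leaves enough room.\<close>

lemma finite_well_order_embed:
  assumes r: "Well_order r" and s: "Well_order s" and fin: "finite (Field r)"
    and card: "finite (Field s) \<Longrightarrow> card (Field r) \<le> card (Field s)"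
  obtains f where "inj_on f (Field r)" "f ` Field r \<subseteq> Field s"
    "\<And>a b. a \<in> Field r \<Longrightarrow> b \<in> Field r \<Longrightarrow> (f a, f b) \<in> s \<longleftrightarrow> (a, b) \<in> r"
proof -
  have "(s, r) \<notin> ordLess"
  proof
    assume "(s, r) \<in> ordLess"
    then obtain f where f: "embed s r f" and nb: "\<not> bij_betw f (Field s) (Field r)"
      unfolding ordLess_def embedS_def by auto
    have inj: "inj_on f (Field s)" and sub: "f ` Field s \<subseteq> Field r"
      using embed_inj_on[OF s f] embed_Field[OF f] by auto
    then have fs: "finite (Field s)" using fin finite_subset inj_on_finite by blast
    then have "f ` Field s = Field r"
      using card_seteq[OF fin sub] card[OF fs] card_image[OF inj] by simp
    with inj nb show False by (simp add: bij_betw_def)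
  qed
  then have "(r, s) \<in> ordLeq" using r s not_ordLess_iff_ordLeq by blast
  then obtain f where f: "embed r s f" unfolding ordLeq_def by blast
  have inj: "inj_on f (Field r)" and sub: "f ` Field r \<subseteq> Field s"
    using embed_inj_on[OF r f] embed_Field[OF f] by auto
  have fwd: "(a, b) \<in> r \<Longrightarrow> (f a, f b) \<in> s" for a b
    using embed_compat[OF f] by (simp add: compat_def)
  \<comment> \<open>An embedding preserves the order by definition; it reflects it because
    \<open>r\<close> is total, \<open>s\<close> antisymmetric and \<open>f\<close>
    injective.\<close>
  have "(f a, f b) \<in> s \<longleftrightarrow> (a, b) \<in> r" if ab: "a \<in> Field r" "b \<in> Field r" for a b
  proof
    assume fab: "(f a, f b) \<in> s"
    show "(a, b) \<in> r"
    proof (rule ccontr)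
      assume n: "(a, b) \<notin> r"
      with r ab have "(b, a) \<in> r" "a \<noteq> b"
        unfolding order_on_defs total_on_def refl_on_def by metis+
      then have "f a = f b" using fwd fab s unfolding order_on_defs antisym_def by blast
      with inj ab \<open>a \<noteq> b\<close> show False by (auto dest: inj_onD)
    qed
  qed (rule fwd)
  with that inj sub show ?thesis by blast
qed

text \<open>Being a copy does not depend on which numbers are used, so elements may be renamed to
  fit a prescribed prefix.\<close>

lemma copies_transport:
  assumes BM: "(B, M) \<in> copies \<beta>" and g: "inj_on g B"
  shows "(g ` B, map_prod g g ` M) \<in> copies \<beta>"
proof -
  let ?r = "M \<union> Id_on B" and ?s = "map_prod g g ` M \<union> Id_on (g ` B)"
  from BM have MId: "M \<inter> Id = {}" and wo: "well_order_on B ?r"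
      and "order_isomorphic ?r \<beta>"
    by (auto simp: copies_def)
  then obtain h where h: "bij_betw h (Field ?r) (Field \<beta>)"
      "\<forall>a\<in>Field ?r. \<forall>b\<in>Field ?r. (a, b) \<in> ?r \<longleftrightarrow> (h a, h b) \<in> \<beta>"
    unfolding order_isomorphic_def by blast
  have B: "Field ?r = B" and W: "Well_order ?r" using well_order_on_Well_order[OF wo] by auto
  have MB: "M \<subseteq> B \<times> B" using B by (auto simp: Field_def)
  \<comment> \<open>The renamed reflexive order is a \<open>dir_image\<close>, which is known to
    preserve well-orders.\<close>
  have s: "?s = dir_image ?r g"
    by (auto simp: dir_image_def Id_on_def image_iff)
  have Fs: "Field ?s = g ` B" unfolding s dir_image_Field B ..
  have "well_order_on (g ` B) ?s"
    using Well_order_dir_image[OF W, of g] g B dir_image_Field[of ?r g] unfolding s by simp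
  moreover have "map_prod g g ` M \<inter> Id = {}"
    using MId MB g by (auto dest: inj_onD)
  moreover have "order_isomorphic ?s \<beta>"
    unfolding order_isomorphic_def Fs
  proof (intro exI conjI ballI)
    show "bij_betw (h \<circ> the_inv_into B g) (g ` B) (Field \<beta>)"
      using bij_betw_trans[OF bij_betw_the_inv_into[OF inj_on_imp_bij_betw[OF g]]] h(1) B by simp
    fix a b assume "a \<in> g ` B" "b \<in> g ` B"
    then obtain x y where xy: "x \<in> B" "y \<in> B" "a = g x" "b = g y" by blast
    have "(g x, g y) \<in> ?s \<longleftrightarrow> (x, y) \<in> ?r"
      using g MB xy unfolding s dir_image_def B by (auto dest: inj_onD)
    with h(2) xy show "(a, b) \<in> ?s \<longleftrightarrow>
        ((h \<circ> the_inv_into B g) a, (h \<circ> the_inv_into B g) b) \<in> \<beta>"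
      unfolding B by (simp add: the_inv_into_f_f[OF g])
  qed
  ultimately show ?thesis by (simp add: copies_def)
qed

text \<open>Entry \<open>n\<close> of a code concerns the number \<open>n div 2\<close> or the pair
  it encodes, whose components do not exceed it. Hence the structure below \<open>N\<close> fixes
  the first \<open>N\<close> entries.\<close>

lemma relstruct_code_eqI:
  assumes A: "A \<inter> {..<N} = A' \<inter> {..<N}"
    and L: "L \<inter> {..<N} \<times> {..<N} = L' \<inter> {..<N} \<times> {..<N}" and n: "n < N"
  shows "relstruct_code (A, L) n = relstruct_code (A', L') n"
proof -
  let ?k = "n div 2"
  have k: "?k < N" using n by simp
  obtain a b where ab: "prod_decode ?k = (a, b)" by fastforce
  then have "?k = prod_encode (a, b)" by (metis prod_decode_inverse)
  then have "a < N" "b < N" using le_prod_encode_1[of a b] le_prod_encode_2[of b a] k by simp_all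
  then have "(a, b) \<in> L \<longleftrightarrow> (a, b) \<in> L'" using L by blast
  moreover have "?k \<in> A \<longleftrightarrow> ?k \<in> A'" using A k by blast
  ultimately show ?thesis by (simp add: relstruct_code_def baire_pair_def ab)
qed

text \<open>A finite part of a copy decides only a finite suborder, which embeds into every ordinal that
  is large enough; the remaining elements are moved out of the way.\<close>

lemma copy_with_given_prefix:
  assumes AL: "(A, L) \<in> copies \<alpha>" and BM: "(B, M) \<in> copies \<beta>"
    and card: "finite B \<Longrightarrow> finite A \<and> card A \<le> card B"
  shows "\<exists>c\<in>copies \<beta>. \<forall>n<N. relstruct_code c n = relstruct_code (A, L) n"
proof -
  let ?rA = "L \<union> Id_on A" and ?rB = "M \<union> Id_on B"
  let ?F = "A \<inter> {..<N}"
  let ?r = "?rA \<inter> ?F \<times> ?F"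
  from AL have LId: "L \<inter> Id = {}" and woA: "well_order_on A ?rA" by (auto simp: copies_def)
  from BM have MId: "M \<inter> Id = {}" and woB: "well_order_on B ?rB" by (auto simp: copies_def)
  have A: "Field ?rA = A" and WA: "Well_order ?rA" using well_order_on_Well_order[OF woA] by auto
  have B: "Field ?rB = B" and WB: "Well_order ?rB" using well_order_on_Well_order[OF woB] by auto
  have LA: "L \<subseteq> A \<times> A" and MB: "M \<subseteq> B \<times> B" using A B by (auto simp: Field_def)
  have Fr: "Field ?r = ?F" by (auto simp: Field_def)
  have le: "card ?F \<le> card B" if "finite B"
    using card[OF that] card_mono[of A ?F] by simp
  obtain f where f: "inj_on f ?F" "f ` ?F \<subseteq> B"
      "\<And>a b. a \<in> ?F \<Longrightarrow> b \<in> ?F \<Longrightarrow> (f a, f b) \<in> ?rB \<longleftrightarrow> (a, b) \<in> ?r"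
    using finite_well_order_embed[OF Well_order_Restr[OF WA] WB, of ?F, unfolded Fr B] le
    by (metis (no_types, lifting) finite_Int finite_lessThan)
  \<comment> \<open>Elements hit by \<open>f\<close> get back the numbers they have in
    \<open>A\<close>; all others are shifted to \<open>N\<close> or beyond, where the prefix cannot
    see them.\<close>
  define g where "g b = (if b \<in> f ` ?F then the_inv_into ?F f b else b + N)" for b
  have gf: "g (f a) = a" if "a \<in> ?F" for a
    using that the_inv_into_f_f[OF f(1)] by (auto simp: g_def)
  have g_ge: "N \<le> g b" if "b \<notin> f ` ?F" for b using that by (simp add: g_def)
  have gF: "b = f (g b) \<and> g b \<in> ?F" if "g b < N" for b
    using that g_ge[of b] gf by (metis (no_types, lifting) imageE not_less)
  have inj: "inj_on g B"
  proof (rule inj_onI)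
    fix x y assume xy: "g x = g y"
    show "x = y"
    proof (cases "g x < N")
      case True
      then show ?thesis using gF[of x] gF[of y] xy by simp
    next
      case False
      then have "x \<notin> f ` ?F" "y \<notin> f ` ?F" using xy gf by auto
      then show ?thesis using xy by (simp add: g_def)
    qed
  qed
  have img: "g ` B \<inter> {..<N} = A \<inter> {..<N}"
  proof
    show "g ` B \<inter> {..<N} \<subseteq> A \<inter> {..<N}" using gF by blast
    show "A \<inter> {..<N} \<subseteq> g ` B \<inter> {..<N}" using gf f(2) by (force simp: image_iff)
  qed
  \<comment> \<open>Codes record the strict order, whereas \<open>f\<close> was obtained for the
    reflexive one; injectivity of \<open>f\<close> bridges the gap.\<close>
  have strict: "(f a, f b) \<in> M \<longleftrightarrow> (a, b) \<in> L" if "a \<in> ?F" "b \<in> ?F" for a b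
  proof -
    have "(f a, f b) \<in> M \<longleftrightarrow> (f a, f b) \<in> ?rB \<and> f a \<noteq> f b" using MId by auto
    also have "\<dots> \<longleftrightarrow> (a, b) \<in> ?rA \<and> a \<noteq> b"
      using f(3)[OF that] that inj_on_eq_iff[OF f(1) that] by simp
    also have "\<dots> \<longleftrightarrow> (a, b) \<in> L" using LId by auto
    finally show ?thesis .
  qed
  have rel: "map_prod g g ` M \<inter> {..<N} \<times> {..<N} = L \<inter> {..<N} \<times> {..<N}"
  proof (intro equalityI subsetI)
    fix z assume "z \<in> map_prod g g ` M \<inter> {..<N} \<times> {..<N}"
    then obtain x y where "(x, y) \<in> M" "z = (g x, g y)" "g x < N" "g y < N" by auto
    then show "z \<in> L \<inter> {..<N} \<times> {..<N}" using gF strict by (metis IntI SigmaI lessThan_iff)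
  next
    fix z assume z: "z \<in> L \<inter> {..<N} \<times> {..<N}"
    then obtain a b where ab: "z = (a, b)" "(a, b) \<in> L" "a \<in> ?F" "b \<in> ?F" using LA by blast
    then have "(f a, f b) \<in> M" using strict by blast
    then have "(g (f a), g (f b)) \<in> map_prod g g ` M" by (metis imageI map_prod_simp)
    then show "z \<in> map_prod g g ` M \<inter> {..<N} \<times> {..<N}" using z ab gf by simp
  qed
  show ?thesis
    using copies_transport[OF BM inj] relstruct_code_eqI[OF img rel] by blast
qed

section \<open>Refuting a reduction\<close>

lemma baire_pair_eqI:
  assumes "\<And>i. i < N \<Longrightarrow> p i = p' i" "\<And>i. i < N \<Longrightarrow> q i = q' i" "n < N"
  shows "baire_pair p q n = baire_pair p' q' n"
  using assms by (simp add: baire_pair_def)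

text \<open>\<open>two_rep\<close> reads only entry 0, so a single value of the backward functional
  carries the whole answer.\<close>

lemma lim2_output_unique:
  assumes "out_rep lim2 s = Some y" "y \<in> solutions lim2 x" "x \<longlonglongrightarrow> l"
  shows "s 0 = l"
  using assms by (auto simp: lim2_def two_rep_def intro: LIMSEQ_unique split: if_splits)

theorem corollary2p25:
  shows "\<not> lim2 \<le>\<^sub>W og_to_alpha"
proof
  assume "lim2 \<le>\<^sub>W og_to_alpha"
  then obtain \<Phi> \<Psi> where \<Psi>: "computable_baire \<Psi>"
    and red: "\<And>p x. in_rep lim2 p = Some x \<Longrightarrow> x \<in> pdom lim2 \<Longrightarrow>
       \<exists>r z. \<Phi> p = Some r \<and> in_rep og_to_alpha r = Some z \<and> z \<in> pdom og_to_alpha \<and>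
         (\<forall>q w. out_rep og_to_alpha q = Some w \<and> w \<in> solutions og_to_alpha z \<longrightarrow>
           (\<exists>s y. \<Psi> (baire_pair p q) = Some s \<and> out_rep lim2 s = Some y \<and> y \<in> solutions lim2 x))"
    unfolding weihrauch_le_def by blast
  from \<Psi> obtain e where e: "\<And>p q n. \<Psi> p = Some q \<Longrightarrow> computes p e [n] (q n)"
    unfolding computable_baire_def by blast
  \<comment> \<open>This forgets the group and keeps only its exponent \<alpha>: \<open>e\<close>
    must give the limit of \<open>x\<close> on every copy of \<alpha>, not just on one.\<close>
  define valid where "valid x \<alpha> \<longleftrightarrow> copies \<alpha> \<noteq> {} \<and>
      (\<forall>c\<in>copies \<alpha>. \<forall>l. x \<longlonglongrightarrow> l \<longrightarrow> computes (baire_pair x (relstruct_code c)) e [0] l)"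
    for x and \<alpha> :: "nat rel"
  have ex_valid: "\<exists>\<alpha>. valid x \<alpha>" if x: "x \<in> cantor" "x \<longlonglongrightarrow> l" for x l
  proof -
    have "in_rep lim2 x = Some x" "x \<in> pdom lim2"
      using x by (auto simp: lim2_def pdom_def rep_of_coding_eq_Some_iff)
    from red[OF this] obtain z where z: "z \<in> pdom og_to_alpha"
      and sol: "\<And>q w. out_rep og_to_alpha q = Some w \<Longrightarrow> w \<in> solutions og_to_alpha z \<Longrightarrow>
           \<exists>s y. \<Psi> (baire_pair x q) = Some s \<and> out_rep lim2 s = Some y \<and> y \<in> solutions lim2 x"
      by blast
    from z obtain c0 and \<alpha> :: "nat rel" and \<epsilon> where z': "z \<in> countable_ogroups" "Well_order \<alpha>"
        "\<epsilon> \<in> {0, 1}" "has_type_ZQ (gle z) \<alpha> \<epsilon>" and c0: "c0 \<in> copies \<alpha>"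
      unfolding pdom_def og_to_alpha_def by auto
    have ne: "copies \<alpha> \<noteq> {}" using c0 by blast
    have \<alpha>: "copies \<alpha> \<subseteq> solutions og_to_alpha z"
      unfolding og_to_alpha_def problem.simps using z' by blast
    have "computes (baire_pair x (relstruct_code c)) e [0] l'"
      if c: "c \<in> copies \<alpha>" and l': "x \<longlonglongrightarrow> l'" for c l'
    proof -
      have cs: "c \<in> solutions og_to_alpha z" using c \<alpha> by blast
      then have "c \<in> relstructs"
        using is_problem_og_to_alpha
        by (auto simp: is_problem_def og_to_alpha_def space_of_rep_of_coding inj_on_relstruct_code)
      then have "out_rep og_to_alpha (relstruct_code c) = Some c"
        by (simp add: og_to_alpha_def rep_of_coding_eq_Some_iff inj_on_relstruct_code)
      from sol[OF this cs] obtain s y where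
        s: "\<Psi> (baire_pair x (relstruct_code c)) = Some s"
          "out_rep lim2 s = Some y" "y \<in> solutions lim2 x" by blast
      then show ?thesis using e[OF s(1), of 0] lim2_output_unique[OF s(2,3) l'] by simp
    qed
    with ne show ?thesis unfolding valid_def by blast
  qed
  \<comment> \<open>Candidates are the universes of copies of ordinals valid for some convergent
    sequence; a smallest one is sought.\<close>
  define cand where "cand A \<longleftrightarrow> (\<exists>x l L \<alpha>. x \<in> cantor \<and> x \<longlonglongrightarrow> l \<and> valid x \<alpha> \<and> (A, L) \<in> copies \<alpha>)" for A
  have "\<exists>A. cand A"
  proof -
    have zero: "(\<lambda>_. 0) \<in> cantor" "(\<lambda>_. 0 :: nat) \<longlonglongrightarrow> 0" by (auto simp: cantor_def)
    from ex_valid[OF this] obtain \<alpha> where \<alpha>: "valid (\<lambda>_. 0) \<alpha>" by blast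
    then obtain A L where "(A, L) \<in> copies \<alpha>" unfolding valid_def by fast
    with zero \<alpha> show ?thesis unfolding cand_def by blast
  qed
  \<comment> \<open>If some candidate is finite, take a finite one of least cardinality; otherwise
    the condition is vacuous and any candidate will do.\<close>
  have "\<exists>A. cand A \<and> (\<forall>B. cand B \<longrightarrow> finite B \<longrightarrow> finite A \<and> card A \<le> card B)"
  proof (cases "\<exists>A. finite A \<and> cand A")
    case True
    then obtain A0 where "finite A0 \<and> cand A0" by blast
    from ex_has_least_nat[of "\<lambda>A. finite A \<and> cand A", OF this, of card] show ?thesis by blast
  next
    case False
    with \<open>\<exists>A. cand A\<close> show ?thesis by blast
  qed
  then obtain A where A: "cand A" "\<And>B. cand B \<Longrightarrow> finite B \<Longrightarrow> finite A \<and> card A \<le> card B"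
    by blast
  then obtain x l L \<alpha> where x: "x \<in> cantor" "x \<longlonglongrightarrow> l" "valid x \<alpha>" "(A, L) \<in> copies \<alpha>"
    unfolding cand_def by blast
  then have "computes (baire_pair x (relstruct_code (A, L))) e [0] l"
    unfolding valid_def by blast
  then obtain m where m: "\<And>p'. \<forall>i<m. p' i = baire_pair x (relstruct_code (A, L)) i \<Longrightarrow>
      computes p' e [0] l"
    using computes_continuous by meson
  \<comment> \<open>In truncated subtraction \<open>1 - l\<close> is 0 or 1 and differs from
    \<open>l\<close> for every natural number \<open>l\<close>.\<close>
  define y where "y n = (if n < m then x n else 1 - l)" for n
  have y: "y \<in> cantor" "y \<longlonglongrightarrow> 1 - l"
  proof -
    show "y \<in> cantor" using x(1) by (auto simp: cantor_def y_def image_subset_iff)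
    show "y \<longlonglongrightarrow> 1 - l"
      by (rule tendsto_eventually) (auto simp: y_def eventually_sequentially intro!: exI[of _ m])
  qed
  obtain \<beta> B M where \<beta>: "valid y \<beta>" "(B, M) \<in> copies \<beta>"
    using ex_valid[OF y] unfolding valid_def by fast
  then have "cand B" using y unfolding cand_def by blast
  \<comment> \<open>Minimality of \<open>A\<close> is exactly the cardinality hypothesis required
    here.\<close>
  from copy_with_given_prefix[OF x(4) \<beta>(2) A(2)[OF this], of m]
  obtain c where c: "c \<in> copies \<beta>" "\<forall>n<m. relstruct_code c n = relstruct_code (A, L) n" by blast
  \<comment> \<open>Entry \<open>i\<close> of a pair reads entry \<open>i div 2\<close> of a
    component, so agreement of both components below \<open>m\<close> suffices.\<close>
  have "computes (baire_pair y (relstruct_code c)) e [0] l"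
    using c(2) by (intro m allI impI baire_pair_eqI[where N = m]) (auto simp: y_def)
  moreover have "computes (baire_pair y (relstruct_code c)) e [0] (1 - l)"
    using \<beta>(1) c(1) y(2) unfolding valid_def by blast
  ultimately have "l = 1 - l" by (rule computes_deterministic)
  then show False by presburger
qed

end
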